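(* Let $G$ be a connected non-transmission-regular graph of order $n$. (1) If $n$ is odd, then \[ D_{\max}(G)-\lambda_1(G)\geq\frac{n+1-\sqrt{(n-1)(n+3)}}{2}, \] with equality if and only if $G\cong K_{1,2,\ldots,2}$ (the complete $r$-partite graph with one part of size $1$ and $r-1$ parts of size $2$, where $n=2r-1$). (2) If $n$ is even, then \[ D_{\max}(G)-\lambda_1(G)\geq\frac{n+2-\sqrt{n^2+4n-4}}{2}, \] with equality if and only if $G$ is isomorphic to some $(n-4)$-DVDR graph.
   Context: All graphs are simple and undirected. For a connected graph $G$, the distance matrix $D(G)$ is the $|V(G)|\times|V(G)|$ matrix whose $(u,v)$-entry is the distance $d(u,v)$ (length of a shortest path) between $u$ and $v$; $\lambda_1(G)$ denotes the largest eigenvalue of $D(G)$ (distance spectral radius). The transmission $D_v$ of a vertex $v$ is $\sum_{w\in V(G)} d(v,w)$; $D_{\max}(G)$ and $D_{\min}(G)$ are the maximum and minimum transmissions over all vertices. $G$ is transmission-regular if $D_{\max}(G)=D_{\min}(G)$, and non-transmission-regular otherwise. A connected graph $G$ on $n$ vertices is an $r$-DVDR graph (distinguished vertex deleted regular) if there is a vertex $v$ of degree $n-1$ such that $G-v$ is $r$-regular. *)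

theory Defs
  imports
    "Jordan_Normal_Form.Spectral_Radius"
    "Graph_Theory.Graph_Theory"
begin

text \<open>
  Finite simple undirected graphs are rendered by the locale \<open>pair_graph\<close>: the edge \<open>uv\<close> is
  the pair of arcs \<open>(u, v)\<close>, \<open>(v, u)\<close>. Hence the degree of a vertex is its \<open>out_degree\<close>,
  \<open>apath\<close> is a path in the usual sense, and \<open>digraph_iso\<close> is graph isomorphism.
\<close>

definition graph_dist :: "'a pair_pre_digraph \<Rightarrow> 'a \<Rightarrow> 'a \<Rightarrow> nat" where
  "graph_dist G u v = (LEAST k. \<exists>p. pre_digraph.apath G u p v \<and> length p = k)"

text \<open>
  Matrices are indexed by \<open>{0..<n}\<close>, so the vertices have to be numbered. The numbering is
  arbitrary: another one changes the distance matrix by a simultaneous permutation of rows and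
  columns, which leaves the spectrum unchanged.
\<close>

definition vertex_list :: "'a pair_pre_digraph \<Rightarrow> 'a list" where
  "vertex_list G = (SOME vs. distinct vs \<and> set vs = pverts G)"

definition distance_matrix :: "'a pair_pre_digraph \<Rightarrow> real mat" where
  "distance_matrix G = mat (card (pverts G)) (card (pverts G))
     (\<lambda>(i, j). real (graph_dist G (vertex_list G ! i) (vertex_list G ! j)))"

definition distance_spectral_radius :: "'a pair_pre_digraph \<Rightarrow> real" where
  "distance_spectral_radius G = Max (spectrum (distance_matrix G))"

definition transmission :: "'a pair_pre_digraph \<Rightarrow> 'a \<Rightarrow> nat" where
  "transmission G v = (\<Sum>w\<in>pverts G. graph_dist G v w)"

definition D_max :: "'a pair_pre_digraph \<Rightarrow> nat" where
  "D_max G = Max (transmission G ` pverts G)"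

definition D_min :: "'a pair_pre_digraph \<Rightarrow> nat" where
  "D_min G = Min (transmission G ` pverts G)"

definition transmission_regular :: "'a pair_pre_digraph \<Rightarrow> bool" where
  "transmission_regular G \<longleftrightarrow> D_max G = D_min G"

definition regular :: "nat \<Rightarrow> ('a, 'b) pre_digraph \<Rightarrow> bool" where
  "regular r G \<longleftrightarrow> (\<forall>v\<in>verts G. out_degree G v = r)"

definition DVDR :: "nat \<Rightarrow> 'a pair_pre_digraph \<Rightarrow> bool" where
  "DVDR r G \<longleftrightarrow> pair_graph G \<and> Digraph_Component.connected G \<and>
     (\<exists>v\<in>pverts G. out_degree G v = card (pverts G) - 1 \<and>
        regular r (pre_digraph.del_vert G v))"

text \<open>The vertex \<open>(i, j)\<close> is the \<open>j\<close>-th vertex of the \<open>i\<close>-th part, which has \<open>ns ! i\<close> vertices.\<close>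

definition complete_multipartite :: "nat list \<Rightarrow> (nat \<times> nat) pair_pre_digraph" where
  "complete_multipartite ns = (let V = {(i, j). i < length ns \<and> j < ns ! i} in
     \<lparr> pverts = V, parcs = {(x, y) \<in> V \<times> V. fst x \<noteq> fst y} \<rparr>)"

end

theory Submission
  imports Defs
begin

text \<open>
  Let \<open>M = D_max G\<close> and let \<open>x\<close> be an eigenvector for the distance spectral radius \<open>\<lambda>\<close>. Then
  \<open>(M - \<lambda>) \<Sum>\<^sub>v x\<^sub>v\<^sup>2 = \<Sum>\<^sub>v (M - D\<^sub>v) x\<^sub>v\<^sup>2 + \<Sum>\<^bsub>{u,v}\<^esub> d(u,v) (x\<^sub>u - x\<^sub>v)\<^sup>2\<close>. Some vertex \<open>w\<close> has
  \<open>c = M - D\<^sub>w \<ge> 1\<close>, and all distances of distinct vertices are at least 1, so the right-hand side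
  dominates \<open>c x\<^sub>w\<^sup>2 + \<Sum>\<^bsub>{u,v}\<^esub> (x\<^sub>u - x\<^sub>v)\<^sup>2\<close>, whose least eigenvalue is the smaller root of
  \<open>t\<^sup>2 - (n + c) t + c\<close>. This gives the bound for odd \<open>n\<close> with \<open>c = 1\<close>. For even \<open>n\<close> the total
  deficit \<open>\<Sum>\<^sub>v (M - D\<^sub>v)\<close> is even, hence at least 2: it is concentrated in a single vertex, which gives the
  bound with \<open>c = 2\<close>, or spread over two vertices, which gives strictly more. Equality forces \<open>w\<close> to be
  adjacent to all vertices, and every other vertex to have exactly \<open>c\<close> non-neighbours.
\<close>

section \<open>The quadratic form of a star perturbation\<close>

text \<open>The smaller root of \<open>t^2 - (n + c) t + c\<close>. Its values for
  \<open>c = 1\<close> and \<open>c = 2\<close> are the two constants of the theorem.\<close>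

definition gap :: "real \<Rightarrow> real \<Rightarrow> real" where
  "gap n c = (n + c - sqrt ((n + c)\<^sup>2 - 4 * c)) / 2"

lemma gap_root:
  assumes "1 \<le> n" "0 < c"
  shows "(gap n c)\<^sup>2 - (n + c) * gap n c + c = 0"
proof -
  have "(n + c)\<^sup>2 - 4 * c = (n - c)\<^sup>2 + 4 * (n - 1) * c"
    by (simp add: power2_eq_square algebra_simps)
  also have "\<dots> \<ge> 0" using assms by simp
  finally have "sqrt ((n + c)\<^sup>2 - 4 * c) ^ 2 = (n + c)\<^sup>2 - 4 * c" by simp
  then show ?thesis
    unfolding gap_def by (simp add: power2_eq_square field_simps)
qed

text \<open>The discriminant lies strictly between \<open>(n + c - 2)^2\<close> and
  \<open>(n + c)^2\<close>. Hence the ratio \<open>1 - gap n c\<close> of the extremal vector is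
  positive, so one may divide by it, and it differs from 1.\<close>

lemma gap_bounds:
  assumes "1 < n" "0 < c"
  shows "0 < gap n c" "gap n c < 1"
proof -
  have "sqrt ((n + c)\<^sup>2 - 4 * c) < sqrt ((n + c)\<^sup>2)"
    using assms by (intro real_sqrt_less_mono) simp
  also have "\<dots> = n + c" using assms by simp
  finally show "0 < gap n c" using assms by (simp add: gap_def)
  have "(n + c - 2)\<^sup>2 < (n + c)\<^sup>2 - 4 * c"
    using assms by (simp add: power2_eq_square algebra_simps)
  then have "n + c - 2 < sqrt ((n + c)\<^sup>2 - 4 * c)"
    by (rule real_less_rsqrt)
  then show "gap n c < 1" by (simp add: gap_def)
qed

lemma sum_sum_diff_squared:
  fixes x :: "'a \<Rightarrow> real"
  shows "(\<Sum>u\<in>V. \<Sum>v\<in>V. (x u - x v)\<^sup>2) = 2 * (card V * (\<Sum>v\<in>V. (x v)\<^sup>2) - (\<Sum>v\<in>V. x v)\<^sup>2)"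
proof -
  have "(\<Sum>u\<in>V. \<Sum>v\<in>V. (x u - x v)\<^sup>2)
      = (\<Sum>u\<in>V. \<Sum>v\<in>V. (x u)\<^sup>2) + (\<Sum>u\<in>V. \<Sum>v\<in>V. (x v)\<^sup>2) - 2 * (\<Sum>u\<in>V. \<Sum>v\<in>V. x u * x v)"
    by (simp add: power2_diff sum.distrib sum_subtractf sum_distrib_left mult.assoc)
  also have "(\<Sum>u\<in>V. \<Sum>v\<in>V. x u * x v) = (\<Sum>v\<in>V. x v)\<^sup>2"
    by (simp add: power2_eq_square sum_product)
  finally show ?thesis by (simp flip: sum_distrib_left)
qed

text \<open>The Laplacian form of the complete graph on \<open>V\<close> plus a diagonal weight
  \<open>c\<close> at \<open>w\<close>. The half corrects for summing over ordered pairs.\<close>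

definition star_form :: "'a set \<Rightarrow> 'a \<Rightarrow> real \<Rightarrow> ('a \<Rightarrow> real) \<Rightarrow> real" where
  "star_form V w c x = c * (x w)\<^sup>2 + (\<Sum>u\<in>V. \<Sum>v\<in>V. (x u - x v)\<^sup>2) / 2"

text \<open>
  The vector with entry \<open>1 - gap n c\<close> at \<open>w\<close> and 1 elsewhere is an eigenvector of the form for its
  least eigenvalue \<open>gap n c\<close>; relative to it the form becomes a sum of squares.
\<close>

lemma star_form_sum_of_squares:
  assumes "finite V" "w \<in> V" "1 < card V" "0 < c"
  defines "a \<equiv> 1 - gap (card V) c"
  shows "star_form V w c x - gap (card V) c * (\<Sum>v\<in>V. (x v)\<^sup>2)
    = (\<Sum>u\<in>V - {w}. \<Sum>v\<in>V - {w}. (x u - x v)\<^sup>2) / 2 + (\<Sum>v\<in>V - {w}. (x w - a * x v)\<^sup>2) / a"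
proof -
  define n where "n = real (card V)"
  define y where "y = x w"
  define S where "S = (\<Sum>v\<in>V - {w}. x v)"
  define Q where "Q = (\<Sum>v\<in>V - {w}. (x v)\<^sup>2)"
  have n: "1 < n" using assms by (simp add: n_def)
  have card: "real (card (V - {w})) = n - 1"
    using assms by (simp add: n_def of_nat_diff)
  have a: "0 < a" and g: "gap n c = 1 - a"
    using gap_bounds[OF n \<open>0 < c\<close>] by (auto simp: a_def n_def)
  \<comment> \<open>The equation of \<open>gap\<close> after substituting \<open>1 - a\<close>. It
    turns the coefficient \<open>(n - 1) / a\<close> of \<open>y^2\<close> into
    \<open>c + n - 2 + a\<close>.\<close>
  have root: "n - 1 = (c + n - 2 + a) * a"
    using gap_root[of n c] n \<open>0 < c\<close> unfolding g by (simp add: power2_eq_square algebra_simps)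
  have sumV: "(\<Sum>v\<in>V. x v) = y + S" "(\<Sum>v\<in>V. (x v)\<^sup>2) = y\<^sup>2 + Q"
    using assms by (simp_all add: sum.remove[of V w] S_def Q_def y_def)
  have "(\<Sum>v\<in>V - {w}. (y - a * x v)\<^sup>2) = (n - 1) * y\<^sup>2 - 2 * a * y * S + a\<^sup>2 * Q"
    by (simp add: power2_diff sum.distrib sum_subtractf card S_def Q_def sum_distrib_left
        power_mult_distrib mult_ac)
  then have R: "(\<Sum>v\<in>V - {w}. (y - a * x v)\<^sup>2) / a = (c + n - 2 + a) * y\<^sup>2 - 2 * y * S + a * Q"
    using a by (simp add: root field_simps power2_eq_square)
  then show ?thesis
    unfolding star_form_def sum_sum_diff_squared card sumV
    unfolding n_def[symmetric] g y_def[symmetric] S_def[symmetric] Q_def[symmetric] R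
    by (simp add: power2_eq_square field_simps)
qed

lemma star_form_ge:
  assumes "finite V" "w \<in> V" "1 < card V" "0 < c"
  shows "gap (card V) c * (\<Sum>v\<in>V. (x v)\<^sup>2) \<le> star_form V w c x"
proof -
  have "0 \<le> star_form V w c x - gap (card V) c * (\<Sum>v\<in>V. (x v)\<^sup>2)"
    unfolding star_form_sum_of_squares[OF assms]
    using gap_bounds[of "card V" c] assms by (intro add_nonneg_nonneg divide_nonneg_nonneg sum_nonneg) auto
  then show ?thesis by simp
qed

text \<open>Equality annihilates both sums of squares; the second one, which compares
  \<open>w\<close> with every other vertex, fixes the ratio of the entries.\<close>

lemma star_form_eqD:
  assumes "finite V" "w \<in> V" "1 < card V" "0 < c"
    and "star_form V w c x = gap (card V) c * (\<Sum>v\<in>V. (x v)\<^sup>2)"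
    and "v \<in> V" "v \<noteq> w"
  shows "x w = (1 - gap (card V) c) * x v"
proof -
  define a where "a = 1 - gap (card V) c"
  have a: "0 < a" using gap_bounds[of "card V" c] assms by (simp add: a_def)
  have "0 \<le> (\<Sum>u\<in>V - {w}. \<Sum>v\<in>V - {w}. (x u - x v)\<^sup>2)"
    by (intro sum_nonneg) auto
  moreover have "0 \<le> (\<Sum>v\<in>V - {w}. (x w - a * x v)\<^sup>2) / a"
    using a by (intro divide_nonneg_pos sum_nonneg) auto
  ultimately have "(\<Sum>v\<in>V - {w}. (x w - a * x v)\<^sup>2) = 0"
    using star_form_sum_of_squares[OF assms(1-4), of x] assms(5) a
    unfolding a_def[symmetric] by (auto simp: add_nonneg_eq_0_iff)
  then show ?thesis
    using assms by (subst (asm) sum_nonneg_eq_0_iff) (auto simp: a_def)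
qed

section \<open>Distance functions on a finite set\<close>

text \<open>The properties of graph distance on which the spectral estimates rest, stated on
  vertices so that no numbering enters.\<close>

locale finite_distance =
  fixes V :: "'a set" and d :: "'a \<Rightarrow> 'a \<Rightarrow> nat"
  assumes finite: "finite V"
    and refl: "v \<in> V \<Longrightarrow> d v v = 0"
    and sym: "u \<in> V \<Longrightarrow> v \<in> V \<Longrightarrow> d u v = d v u"
    and pos: "u \<in> V \<Longrightarrow> v \<in> V \<Longrightarrow> u \<noteq> v \<Longrightarrow> 0 < d u v"
begin

definition T :: "'a \<Rightarrow> nat" where
  "T v = (\<Sum>u\<in>V. d v u)"

text \<open>Every unordered pair is counted twice. In the induction a new vertex contributes its row
  and its column, which agree by symmetry.\<close>

lemma even_sum_T: "even (\<Sum>v\<in>V. T v)"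
proof -
  have "even (\<Sum>v\<in>U. \<Sum>u\<in>U. d v u)" if "U \<subseteq> V" for U
    using finite_subset[OF that finite] that
  proof (induction U rule: finite_induct)
    case (insert w U)
    have "(\<Sum>v\<in>U. d v w) = (\<Sum>u\<in>U. d w u)"
      using insert.prems by (intro sum.cong sym) auto
    then have "(\<Sum>v\<in>insert w U. \<Sum>u\<in>insert w U. d v u) = (\<Sum>v\<in>U. \<Sum>u\<in>U. d v u) + 2 * (\<Sum>u\<in>U. d w u)"
      using insert.hyps insert.prems by (simp add: sum.distrib refl)
    then show ?case using insert by simp
  qed simp
  then show ?thesis by (simp add: T_def)
qed

text \<open>Expanding the square, the two pure terms both give the sum of
  \<open>T v * (x v)^2\<close> by symmetry, and the mixed term is the quadratic form of the distance
  matrix, evaluated by the eigenvalue equation.\<close>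

lemma eigen_energy:
  fixes lam :: real and M :: nat and x :: "'a \<Rightarrow> real"
  assumes eigen: "\<And>v. v \<in> V \<Longrightarrow> (\<Sum>u\<in>V. d v u * x u) = lam * x v"
  shows "(M - lam) * (\<Sum>v\<in>V. (x v)\<^sup>2)
    = (\<Sum>v\<in>V. (real M - T v) * (x v)\<^sup>2) + (\<Sum>u\<in>V. \<Sum>v\<in>V. d u v * (x u - x v)\<^sup>2) / 2"
proof -
  have 1: "(\<Sum>u\<in>V. \<Sum>v\<in>V. d u v * (x u)\<^sup>2) = (\<Sum>u\<in>V. T u * (x u)\<^sup>2)"
    by (simp add: T_def sum_distrib_right)
  have "(\<Sum>u\<in>V. \<Sum>v\<in>V. d u v * (x v)\<^sup>2) = (\<Sum>v\<in>V. \<Sum>u\<in>V. d v u * (x v)\<^sup>2)"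
    by (subst sum.swap) (intro sum.cong, auto simp: sym)
  then have 2: "(\<Sum>u\<in>V. \<Sum>v\<in>V. d u v * (x v)\<^sup>2) = (\<Sum>u\<in>V. T u * (x u)\<^sup>2)"
    using 1 by simp
  have "(\<Sum>u\<in>V. \<Sum>v\<in>V. d u v * (x u * x v)) = (\<Sum>u\<in>V. x u * (\<Sum>v\<in>V. d u v * x v))"
    by (simp add: sum_distrib_left mult_ac)
  also have "\<dots> = (\<Sum>u\<in>V. x u * (lam * x u))"
    by (simp add: eigen)
  also have "\<dots> = lam * (\<Sum>u\<in>V. (x u)\<^sup>2)"
    by (simp add: sum_distrib_left power2_eq_square mult_ac)
  finally have 3: "(\<Sum>u\<in>V. \<Sum>v\<in>V. d u v * (x u * x v)) = lam * (\<Sum>u\<in>V. (x u)\<^sup>2)" .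
  have "(\<Sum>u\<in>V. \<Sum>v\<in>V. d u v * (x u - x v)\<^sup>2)
    = (\<Sum>u\<in>V. \<Sum>v\<in>V. d u v * (x u)\<^sup>2) + (\<Sum>u\<in>V. \<Sum>v\<in>V. d u v * (x v)\<^sup>2)
      - 2 * (\<Sum>u\<in>V. \<Sum>v\<in>V. d u v * (x u * x v))"
    by (simp add: power2_diff algebra_simps sum.distrib sum_subtractf sum_distrib_left)
  then have "(\<Sum>u\<in>V. \<Sum>v\<in>V. d u v * (x u - x v)\<^sup>2)
    = 2 * (\<Sum>u\<in>V. T u * (x u)\<^sup>2) - 2 * (lam * (\<Sum>u\<in>V. (x u)\<^sup>2))"
    unfolding 1 2 3 by simp
  moreover have "(\<Sum>v\<in>V. (real M - T v) * (x v)\<^sup>2) = M * (\<Sum>v\<in>V. (x v)\<^sup>2) - (\<Sum>v\<in>V. T v * (x v)\<^sup>2)"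
    by (simp add: left_diff_distrib sum_subtractf sum_distrib_left)
  moreover have "(M - lam) * (\<Sum>v\<in>V. (x v)\<^sup>2) = M * (\<Sum>v\<in>V. (x v)\<^sup>2) - lam * (\<Sum>v\<in>V. (x v)\<^sup>2)"
    by (rule left_diff_distrib)
  ultimately show ?thesis by linarith
qed

lemma real_d_ge:
  fixes x :: "'a \<Rightarrow> real"
  assumes that: "u \<in> V" "v \<in> V"
  shows "(x u - x v)\<^sup>2 \<le> d u v * (x u - x v)\<^sup>2"
proof (cases "u = v")
  case False
  with pos[OF that] show ?thesis
    using mult_right_mono[of 1 "real (d u v)" "(x u - x v)\<^sup>2"] by auto
qed simp

end

section \<open>Spectral estimates from an eigenvector of the distance function\<close>

locale eigen_distance = finite_distance +
  fixes M :: nat and lam :: real and x :: "'a \<Rightarrow> real"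
  assumes T_le: "v \<in> V \<Longrightarrow> T v \<le> M"
    and eigen: "v \<in> V \<Longrightarrow> (\<Sum>u\<in>V. d v u * x u) = lam * x v"
    and nonzero: "\<exists>v\<in>V. x v \<noteq> 0"
begin

lemma norm_pos: "0 < (\<Sum>v\<in>V. (x v)\<^sup>2)"
  using nonzero finite by (auto intro!: sum_pos2)

lemma deficit_nonneg: "0 \<le> (real M - T v) * (x v)\<^sup>2" if "v \<in> V"
  using T_le[OF that] by simp

lemma energy: "(M - lam) * (\<Sum>v\<in>V. (x v)\<^sup>2)
    = (\<Sum>v\<in>V. (real M - T v) * (x v)\<^sup>2) + (\<Sum>u\<in>V. \<Sum>v\<in>V. d u v * (x u - x v)\<^sup>2) / 2"
  by (rule eigen_energy) (rule eigen)

text \<open>What the star form discards: the deficit at \<open>w\<close> beyond \<open>c\<close>,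
  the deficits elsewhere, and the distances beyond 1. With \<open>c\<close> at most the deficit of
  \<open>w\<close> each part is nonnegative, which yields the bound; their vanishing yields the
  equality conditions.\<close>

lemma energy_excess:
  fixes c :: real
  assumes "w \<in> V"
  shows "(M - lam) * (\<Sum>v\<in>V. (x v)\<^sup>2) - star_form V w c x
    = (real M - T w - c) * (x w)\<^sup>2 + (\<Sum>v\<in>V - {w}. (real M - T v) * (x v)\<^sup>2)
      + (\<Sum>u\<in>V. \<Sum>v\<in>V. d u v * (x u - x v)\<^sup>2 - (x u - x v)\<^sup>2) / 2"
proof -
  have "(\<Sum>v\<in>V. (real M - T v) * (x v)\<^sup>2)
      = (real M - T w) * (x w)\<^sup>2 + (\<Sum>v\<in>V - {w}. (real M - T v) * (x v)\<^sup>2)"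
    using assms finite by (rule sum.remove[rotated])
  then show ?thesis
    unfolding energy star_form_def sum_subtractf
    by (simp add: diff_divide_distrib left_diff_distrib[of "_ - _"])
qed

lemma gap_le:
  fixes c :: real
  assumes "w \<in> V" "1 < card V" "0 < c" "c \<le> real M - T w"
  shows "gap (card V) c \<le> M - lam"
proof -
  have "0 \<le> (real M - T w - c) * (x w)\<^sup>2" using assms T_le[OF \<open>w \<in> V\<close>] by simp
  moreover have "0 \<le> (\<Sum>v\<in>V - {w}. (real M - T v) * (x v)\<^sup>2)"
    by (intro sum_nonneg) (use deficit_nonneg in auto)
  moreover have "0 \<le> (\<Sum>u\<in>V. \<Sum>v\<in>V. d u v * (x u - x v)\<^sup>2 - (x u - x v)\<^sup>2)"
    by (intro sum_nonneg) (use real_d_ge in auto)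
  ultimately have "star_form V w c x \<le> (M - lam) * (\<Sum>v\<in>V. (x v)\<^sup>2)"
    using energy_excess[OF \<open>w \<in> V\<close>, of c] by simp
  with star_form_ge[OF finite assms(1-3), of x]
  have "gap (card V) c * (\<Sum>v\<in>V. (x v)\<^sup>2) \<le> (M - lam) * (\<Sum>v\<in>V. (x v)\<^sup>2)"
    by linarith
  then show ?thesis using norm_pos by simp
qed

text \<open>Equality forces \<open>x w = a * x v\<close> with \<open>0 < a < 1\<close>. Thus no
  entry vanishes and \<open>x w\<close> differs from all others, so each vanishing weighted square
  forces its weight to vanish.\<close>

lemma gap_eqD:
  fixes c :: real
  assumes "w \<in> V" "1 < card V" "0 < c" "c \<le> real M - T w"
    and eq: "M - lam = gap (card V) c"
  shows "real M - T w = c" and "v \<in> V \<Longrightarrow> v \<noteq> w \<Longrightarrow> T v = M" and "v \<in> V \<Longrightarrow> v \<noteq> w \<Longrightarrow> d w v = 1"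
proof -
  define a where "a = 1 - gap (card V) c"
  have a: "0 < a" "a < 1" using gap_bounds[of "card V" c] assms by (auto simp: a_def)
  let ?A = "(real M - T w - c) * (x w)\<^sup>2" and ?B = "(\<Sum>v\<in>V - {w}. (real M - T v) * (x v)\<^sup>2)"
    and ?C = "(\<Sum>u\<in>V. \<Sum>v\<in>V. d u v * (x u - x v)\<^sup>2 - (x u - x v)\<^sup>2)"
  have A: "0 \<le> ?A" using assms T_le[OF \<open>w \<in> V\<close>] by simp
  have B: "0 \<le> ?B"
    by (intro sum_nonneg) (use deficit_nonneg in auto)
  have C: "0 \<le> ?C"
    by (intro sum_nonneg) (use real_d_ge in auto)
  \<comment> \<open>The chain from \<open>gap\<close> times the squared norm through the star form
    to the energy has equal ends, so every link is tight.\<close>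
  have sf: "star_form V w c x = gap (card V) c * (\<Sum>v\<in>V. (x v)\<^sup>2)"
    and zero: "?A = 0" "?B = 0" "?C = 0"
    using A B C energy_excess[OF \<open>w \<in> V\<close>, of c] star_form_ge[OF finite assms(1-3), of x]
    unfolding eq by linarith+
  have xw: "x w = a * x v" if "v \<in> V" "v \<noteq> w" for v
    using star_form_eqD[OF finite assms(1-3) sf that] by (simp add: a_def)
  have "x w \<noteq> 0"
    using nonzero xw a by force
  then have xv: "x v \<noteq> 0" "x w \<noteq> x v" if "v \<in> V" "v \<noteq> w" for v
    using xw[OF that] a by auto
  show "real M - T w = c" using zero(1) \<open>x w \<noteq> 0\<close> by (simp only: mult_eq_0_iff) simp
  show "T v = M" if v: "v \<in> V" "v \<noteq> w"
  proof -
    have "(real M - T v) * (x v)\<^sup>2 = 0"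
      using zero(2) v finite deficit_nonneg by (subst (asm) sum_nonneg_eq_0_iff) auto
    then show ?thesis using xv[OF v] by simp
  qed
  show "d w v = 1" if v: "v \<in> V" "v \<noteq> w"
  proof -
    have "(\<Sum>v\<in>V. d w v * (x w - x v)\<^sup>2 - (x w - x v)\<^sup>2) = 0"
      using zero(3) \<open>w \<in> V\<close> finite real_d_ge
      by (subst (asm) sum_nonneg_eq_0_iff) (auto intro!: sum_nonneg)
    then have "d w v * (x w - x v)\<^sup>2 - (x w - x v)\<^sup>2 = 0"
      using v(1) \<open>w \<in> V\<close> finite real_d_ge
      by (subst (asm) sum_nonneg_eq_0_iff) auto
    then show ?thesis using xv[OF v] by simp
  qed
qed

text \<open>
  With two deficient vertices the form dominates the average of the two star forms of weight 2;
  equality in both would force the vector to vanish, as seen at the third vertex.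
\<close>

lemma gap_less_two_deficits:
  assumes w: "w \<in> V" "w' \<in> V" "w \<noteq> w'" "T w < M" "T w' < M"
    and z: "z \<in> V" "T z = M"
  shows "gap (card V) 2 < M - lam"
proof -
  let ?g = "gap (card V) 2" and ?N = "\<Sum>v\<in>V. (x v)\<^sup>2"
  have "card {w, w'} \<le> card V"
    using w finite by (intro card_mono) auto
  then have card: "1 < card V" using w by simp
  have zw: "z \<noteq> w" "z \<noteq> w'" using w z by auto
  have "(x w)\<^sup>2 + (x w')\<^sup>2 = (\<Sum>v\<in>{w, w'}. (x v)\<^sup>2)" using w by simp
  also have "\<dots> \<le> (\<Sum>v\<in>{w, w'}. (real M - T v) * (x v)\<^sup>2)"
  proof (intro sum_mono)
    fix v assume "v \<in> {w, w'}"
    then have "1 \<le> real M - T v" using w by auto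
    then show "(x v)\<^sup>2 \<le> (real M - T v) * (x v)\<^sup>2" using mult_right_mono by fastforce
  qed
  also have "\<dots> \<le> (\<Sum>v\<in>V. (real M - T v) * (x v)\<^sup>2)"
    using w deficit_nonneg by (intro sum_mono2 finite) auto
  finally have 1: "(x w)\<^sup>2 + (x w')\<^sup>2 \<le> (\<Sum>v\<in>V. (real M - T v) * (x v)\<^sup>2)" .
  have 2: "(\<Sum>u\<in>V. \<Sum>v\<in>V. (x u - x v)\<^sup>2) \<le> (\<Sum>u\<in>V. \<Sum>v\<in>V. d u v * (x u - x v)\<^sup>2)"
    by (intro sum_mono real_d_ge)
  \<comment> \<open>Averaging halves the two weights 2 to weights 1, which deficits of at least 1 at
    \<open>w\<close> and \<open>w'\<close> cover.\<close>
  have avg: "star_form V w 2 x + star_form V w' 2 x \<le> 2 * ((M - lam) * ?N)"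
    using 1 2 unfolding energy star_form_def by simp
  have ge: "?g * ?N \<le> star_form V w 2 x" "?g * ?N \<le> star_form V w' 2 x"
    using star_form_ge[OF finite] w card by auto
  show ?thesis
  proof (rule ccontr)
    assume "\<not> ?thesis"
    then have "(M - lam) * ?N \<le> ?g * ?N" using norm_pos by simp
    then have eq: "star_form V w 2 x = ?g * ?N" "star_form V w' 2 x = ?g * ?N"
      using avg ge by auto
    have a: "0 < 1 - ?g" "1 - ?g < 1" using gap_bounds[of "card V" 2] card by auto
    have xw: "x w = (1 - ?g) * x v" if "v \<in> V" "v \<noteq> w" for v
      using star_form_eqD[OF finite w(1) card _ eq(1) that] by simp
    \<comment> \<open>Seen from \<open>w'\<close>, the entry is \<open>1 - ?g\<close> times
      \<open>x z\<close>; seen from \<open>w\<close>, that product is \<open>x w\<close>, which is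
      also \<open>1 - ?g\<close> times \<open>x w'\<close>. Hence \<open>x w'\<close> is a fixed
      point of multiplication by a factor below 1.\<close>
    have "x w' = (1 - ?g) * x z"
      using star_form_eqD[OF finite w(2) card _ eq(2) z(1)] zw by simp
    moreover have "(1 - ?g) * x z = (1 - ?g) * x w'"
      using xw[OF z(1) zw(1)] xw[OF w(2)] w(3) by metis
    ultimately have "x w' = 0" using a by auto
    then have "x w = 0" using xw[OF w(2)] w(3) by simp
    then have "x v = 0" if "v \<in> V" for v
      using xw[OF that] a by auto
    then show False using nonzero by blast
  qed
qed

end

section \<open>The distance spectral radius as a largest eigenvalue\<close>

lemma eigenvector_iff_sum:
  fixes A :: "'a :: comm_ring_1 mat"
  assumes A: "A \<in> carrier_mat n n"
  shows "eigenvector A v k \<longleftrightarrow> v \<in> carrier_vec n \<and> (\<exists>i<n. v $ i \<noteq> 0) \<and>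
    (\<forall>i<n. (\<Sum>j<n. A $$ (i, j) * v $ j) = k * v $ i)"
proof (cases "v \<in> carrier_vec n")
  case True
  then have v: "dim_vec v = n" by simp
  have dim: "dim_row A = n" "dim_col A = n" using A by auto
  have "(A *\<^sub>v v) $ i = (\<Sum>j<n. A $$ (i, j) * v $ j)" if "i < n" for i
    using that by (simp add: dim v scalar_prod_def lessThan_atLeast0)
  then have "A *\<^sub>v v = k \<cdot>\<^sub>v v \<longleftrightarrow> (\<forall>i<n. (\<Sum>j<n. A $$ (i, j) * v $ j) = k * v $ i)"
    by (auto simp: vec_eq_iff dim v)
  moreover have "v \<noteq> 0\<^sub>v n \<longleftrightarrow> (\<exists>i<n. v $ i \<noteq> 0)"
    by (auto simp: vec_eq_iff v)
  ultimately show ?thesis using True by (simp add: eigenvector_def dim)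
qed (use A in \<open>auto simp: eigenvector_def\<close>)

text \<open>A complex eigenvalue exists, and it is real because the Hermitian form of a real
  symmetric matrix takes real values. This keeps the real spectrum non-empty, so that its
  \<open>Max\<close> is meaningful.\<close>

lemma symmetric_real_eigenvalue_exists:
  fixes A :: "real mat"
  assumes A: "A \<in> carrier_mat n n" "0 < n"
    and sym: "\<And>i j. i < n \<Longrightarrow> j < n \<Longrightarrow> A $$ (i, j) = A $$ (j, i)"
  shows "\<exists>k. eigenvalue A k"
proof -
  define B where "B = map_mat complex_of_real A"
  have Bij: "B $$ (i, j) = of_real (A $$ (i, j))" if "i < n" "j < n" for i j
    using A that by (auto simp: B_def)
  have B: "B \<in> carrier_mat n n" using A by (simp add: B_def)
  obtain k where k: "eigenvalue B k"
    using spectrum_non_empty[OF B A(2)] by (auto simp: spectrum_def)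
  then obtain v where "eigenvector B v k" by (auto simp: eigenvalue_def)
  then have nz: "\<exists>i<n. v $ i \<noteq> 0" and ev: "\<And>i. i < n \<Longrightarrow> (\<Sum>j<n. B $$ (i, j) * v $ j) = k * v $ i"
    by (auto simp: eigenvector_iff_sum[OF B])
  define N where "N = (\<Sum>i<n. (cmod (v $ i))\<^sup>2)"
  have "N \<noteq> 0"
    using nz by (auto simp: N_def sum_nonneg_eq_0_iff)
  define q where "q = (\<Sum>i<n. \<Sum>j<n. of_real (A $$ (i, j)) * (cnj (v $ i) * v $ j))"
  have "q = (\<Sum>i<n. cnj (v $ i) * (\<Sum>j<n. B $$ (i, j) * v $ j))"
    unfolding q_def sum_distrib_left by (intro sum.cong) (auto simp: Bij mult_ac)
  also have "\<dots> = (\<Sum>i<n. cnj (v $ i) * (k * v $ i))"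
    by (intro sum.cong) (auto simp: ev)
  also have "\<dots> = (\<Sum>i<n. k * of_real ((cmod (v $ i))\<^sup>2))"
    by (intro sum.cong) (simp_all only: complex_norm_square mult_ac)
  finally have q: "q = k * of_real N"
    by (simp add: N_def sum_distrib_left)
  have "cnj q = (\<Sum>i<n. \<Sum>j<n. of_real (A $$ (j, i)) * (cnj (v $ j) * v $ i))"
    unfolding q_def cnj_sum by (intro sum.cong) (auto simp: sym mult_ac)
  also have "\<dots> = q" unfolding q_def by (rule sum.swap)
  finally have "cnj k = k" using \<open>N \<noteq> 0\<close> by (simp add: q)
  then obtain r where r: "k = of_real r"
    by (auto simp: complex_eq_iff intro: that[of "Re k"])
  \<comment> \<open>Descent to the reals by the characteristic polynomial, since the complex
    eigenvector need not be real.\<close>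
  have "of_real (poly (char_poly A) r) = poly (char_poly B) k"
    unfolding B_def r of_real_hom.char_poly_hom[OF A(1)] by simp
  then have "poly (char_poly A) r = 0"
    using k eigenvalue_root_char_poly[OF B] by simp
  then show ?thesis using eigenvalue_root_char_poly[OF A(1)] by blast
qed

text \<open>Eigenvectors as functions on vertices, which frees all later arguments from the
  arbitrary \<open>vertex_list\<close>.\<close>

definition distance_eigenpair :: "'a pair_pre_digraph \<Rightarrow> real \<Rightarrow> ('a \<Rightarrow> real) \<Rightarrow> bool" where
  "distance_eigenpair G lam x \<longleftrightarrow> (\<exists>v\<in>pverts G. x v \<noteq> 0) \<and>
    (\<forall>v\<in>pverts G. (\<Sum>u\<in>pverts G. real (graph_dist G v u) * x u) = lam * x v)"

lemma eigenvalue_distance_matrix_iff: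
  assumes "finite (pverts G)"
  shows "eigenvalue (distance_matrix G) lam \<longleftrightarrow> (\<exists>x. distance_eigenpair G lam x)"
proof -
  define vs where "vs = vertex_list G"
  define n where "n = card (pverts G)"
  \<comment> \<open>Finiteness supplies an enumeration, so the \<open>SOME\<close> in
    \<open>vertex_list\<close> really picks one.\<close>
  have "distinct vs \<and> set vs = pverts G"
    unfolding vs_def vertex_list_def using finite_distinct_list[OF assms] by (metis (mono_tags, lifting) someI_ex)
  then have bij: "bij_betw (nth vs) {..<n} (pverts G)"
    by (intro bij_betw_nth) (auto simp: n_def distinct_card[symmetric])
  have carrier: "distance_matrix G \<in> carrier_mat n n"
    by (simp add: distance_matrix_def n_def)
  have vertex: "(\<forall>v\<in>pverts G. P v) \<longleftrightarrow> (\<forall>i<n. P (vs ! i))" for P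
    unfolding bij_betw_imp_surj_on[OF bij, symmetric] by auto
  have key: "eigenvector (distance_matrix G) w lam \<longleftrightarrow> distance_eigenpair G lam x"
    if w: "w \<in> carrier_vec n" "\<And>i. i < n \<Longrightarrow> w $ i = x (vs ! i)" for w x
  proof -
    have "(\<Sum>j<n. distance_matrix G $$ (i, j) * w $ j) = (\<Sum>u\<in>pverts G. real (graph_dist G (vs ! i) u) * x u)"
      if "i < n" for i
      unfolding sum.reindex_bij_betw[OF bij, symmetric]
      using that w by (intro sum.cong) (auto simp: distance_matrix_def n_def vs_def)
    moreover have "(\<exists>v\<in>pverts G. x v \<noteq> 0) \<longleftrightarrow> (\<exists>i<n. x (vs ! i) \<noteq> 0)"
      using vertex[of "\<lambda>v. x v = 0"] by auto
    ultimately show ?thesis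
      unfolding eigenvector_iff_sum[OF carrier] distance_eigenpair_def vertex
      using w by auto
  qed
  show ?thesis
  proof
    assume "eigenvalue (distance_matrix G) lam"
    then obtain w where w: "eigenvector (distance_matrix G) w lam" by (auto simp: eigenvalue_def)
    define x where "x u = w $ the_inv_into {..<n} (nth vs) u" for u
    have "w $ i = x (vs ! i)" if "i < n" for i
      using bij that by (simp add: x_def the_inv_into_f_f bij_betw_def)
    moreover have "w \<in> carrier_vec n" using w by (simp add: eigenvector_iff_sum[OF carrier])
    ultimately show "\<exists>x. distance_eigenpair G lam x" using key w by blast
  next
    assume "\<exists>x. distance_eigenpair G lam x"
    then obtain x where "distance_eigenpair G lam x" ..
    then have "eigenvector (distance_matrix G) (vec n (\<lambda>i. x (vs ! i))) lam"
      by (subst key) auto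
    then show "eigenvalue (distance_matrix G) lam" by (auto simp: eigenvalue_def)
  qed
qed

section \<open>Distances in a connected graph\<close>


locale connected_pair_graph = pair_graph G for G :: "'a pair_pre_digraph" +
  assumes connected: "Digraph_Component.connected G"
begin

lemma nonempty: "pverts G \<noteq> {}"
  using connected by (simp add: connected_conv)

text \<open>Connectedness provides some path, so the \<open>LEAST\<close> in
  \<open>graph_dist\<close> is attained.\<close>

lemma graph_dist_path:
  assumes "u \<in> pverts G" "v \<in> pverts G"
  shows "\<exists>p. apath u p v \<and> length p = graph_dist G u v"
proof -
  have "strongly_connected G"
    using symmetric_connected_imp_strongly_connected[OF pair_sym_arcs connected] .
  then have "\<exists>p. apath u p v"
    using assms reachable_apath by (auto simp: strongly_connected_def)
  then show ?thesis
    using LeastI_ex[of "\<lambda>k. \<exists>p. apath u p v \<and> length p = k"] unfolding graph_dist_def by blast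
qed

lemma graph_dist_le: "apath u p v \<Longrightarrow> graph_dist G u v \<le> length p"
  unfolding graph_dist_def by (intro Least_le) auto

lemma graph_dist_refl: "v \<in> pverts G \<Longrightarrow> graph_dist G v v = 0"
  using graph_dist_le[of v "[]" v] by (simp add: apath_Nil_iff)

lemma graph_dist_sym: "graph_dist G u v = graph_dist G v u"
proof -
  have "(\<exists>p. apath u p v \<and> length p = k) \<longleftrightarrow> (\<exists>p. apath v p u \<and> length p = k)" for k
  proof -
    have "length (rev_path p) = length p" for p :: "('a \<times> 'a) list"
      by (induction p) auto
    then show ?thesis by (metis apath_rev_path)
  qed
  then show ?thesis by (simp add: graph_dist_def)
qed

lemma graph_dist_pos:
  assumes "u \<in> pverts G" "v \<in> pverts G" "u \<noteq> v"
  shows "0 < graph_dist G u v"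
proof (rule ccontr)
  assume "\<not> ?thesis"
  with graph_dist_path[OF assms(1,2)] have "apath u [] v" by auto
  then show False using assms by (simp add: apath_Nil_iff)
qed

lemma graph_dist_eq_1_iff:
  assumes "u \<in> pverts G" "v \<in> pverts G"
  shows "graph_dist G u v = 1 \<longleftrightarrow> (u, v) \<in> parcs G"
proof
  assume "graph_dist G u v = 1"
  with graph_dist_path[OF assms] obtain e where "apath u [e] v"
    by (metis One_nat_def length_0_conv length_Suc_conv)
  then have "e \<in> parcs G" "e = (u, v)" by (auto simp: apath_simps)
  then show "(u, v) \<in> parcs G" by simp
next
  assume uv: "(u, v) \<in> parcs G"
  then have "u \<noteq> v" using no_loops' by blast
  moreover have "apath u [(u, v)] v" using uv assms \<open>u \<noteq> v\<close> by (simp add: apath_simps)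
  ultimately show "graph_dist G u v = 1"
    using graph_dist_le graph_dist_pos[OF assms] by fastforce
qed

lemma graph_dist_le_2:
  assumes "(u, w) \<in> parcs G" "(w, v) \<in> parcs G"
  shows "graph_dist G u v \<le> 2"
\<comment> \<open>For \<open>u = v\<close> the walk through \<open>w\<close> repeats a vertex and is
  not an \<open>apath\<close>.\<close>
proof (cases "u = v")
  case True
  then show ?thesis using graph_dist_refl in_arcsD1[OF assms(1)] by simp
next
  case False
  moreover have "u \<noteq> w" "w \<noteq> v" using assms no_loops' by blast+
  ultimately have "apath u [(u, w), (w, v)] v"
    using assms in_arcsD1[OF assms(1)] in_arcsD2[OF assms(2)] in_arcsD1[OF assms(2)]
    by (simp add: apath_simps)
  then show ?thesis using graph_dist_le by fastforce
qed

sublocale finite_distance "pverts G" "graph_dist G"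
  by unfold_locales (auto simp: pair_finite_verts graph_dist_refl graph_dist_sym graph_dist_pos)

lemma T_eq_transmission: "T v = transmission G v"
  by (simp add: T_def transmission_def)

lemma transmission_le_D_max: "v \<in> pverts G \<Longrightarrow> transmission G v \<le> D_max G"
  unfolding D_max_def using pair_finite_verts by (intro Max_ge) auto

text \<open>\<open>Max\<close> behaves as intended because the spectrum is finite and non-empty. The
  first fact supplies the vector for lower bounds on the gap, the second turns explicit eigenpairs
  into upper bounds.\<close>

lemma
  shows distance_spectral_radius_eigenpair: "\<exists>x. distance_eigenpair G (distance_spectral_radius G) x"
    and distance_spectral_radius_ge: "distance_eigenpair G lam x \<Longrightarrow> lam \<le> distance_spectral_radius G"
proof -
  have carrier: "distance_matrix G \<in> carrier_mat (card (pverts G)) (card (pverts G))"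
    by (simp add: distance_matrix_def)
  have "0 < card (pverts G)" using nonempty pair_finite_verts by (simp add: card_gt_0_iff)
  moreover have "distance_matrix G $$ (i, j) = distance_matrix G $$ (j, i)"
    if "i < card (pverts G)" "j < card (pverts G)" for i j
    using that graph_dist_sym by (simp add: distance_matrix_def)
  ultimately have ne: "spectrum (distance_matrix G) \<noteq> {}"
    using symmetric_real_eigenvalue_exists[OF carrier] by (auto simp: spectrum_def)
  note fin = card_finite_spectrum(1)[OF carrier]
  have iff: "lam \<in> spectrum (distance_matrix G) \<longleftrightarrow> (\<exists>x. distance_eigenpair G lam x)" for lam
    using eigenvalue_distance_matrix_iff[OF pair_finite_verts] by (simp add: spectrum_def)
  show "\<exists>x. distance_eigenpair G (distance_spectral_radius G) x"
    using Max_in[OF fin ne] unfolding distance_spectral_radius_def iff .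
  show "lam \<le> distance_spectral_radius G" if "distance_eigenpair G lam x"
    using Max_ge[OF fin] that iff unfolding distance_spectral_radius_def by blast
qed

lemma eigen_distanceI:
  "distance_eigenpair G lam x \<Longrightarrow> eigen_distance (pverts G) (graph_dist G) (D_max G) lam x"
  by unfold_locales (auto simp: distance_eigenpair_def T_eq_transmission transmission_le_D_max)

end

section \<open>Graphs with a dominating vertex\<close>

definition nonneighbours :: "'a pair_pre_digraph \<Rightarrow> 'a \<Rightarrow> 'a set" where
  "nonneighbours G u = {z \<in> pverts G. z \<noteq> u \<and> (u, z) \<notin> parcs G}"

text \<open>The extremal structure for both parities: \<open>c = 1\<close> will be shown to describe
  \<open>K_{1,2,...,2}\<close>, and \<open>c = 2\<close> the DVDR graphs.\<close>

definition hub :: "'a pair_pre_digraph \<Rightarrow> 'a \<Rightarrow> nat \<Rightarrow> bool" where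
  "hub G w c \<longleftrightarrow> w \<in> pverts G \<and>
    (\<forall>u\<in>pverts G - {w}. (w, u) \<in> parcs G \<and> card (nonneighbours G u) = c)"

context connected_pair_graph
begin

lemma finite_nonneighbours: "finite (nonneighbours G u)"
  using pair_finite_verts by (simp add: nonneighbours_def)

lemma graph_dist_dominated:
  assumes "\<And>z. z \<in> pverts G \<Longrightarrow> z \<noteq> w \<Longrightarrow> (w, z) \<in> parcs G"
    and "u \<in> pverts G" "v \<in> pverts G"
  shows "graph_dist G u v \<le> 2"
proof -
  consider "u = v" | "u \<noteq> v" "u = w \<or> v = w" | "u \<noteq> w" "v \<noteq> w" by blast
  then show ?thesis
  proof cases
    case 1
    then show ?thesis using assms graph_dist_refl by simp
  next
    case 2
    then have "(u, v) \<in> parcs G" using assms arcs_symmetric by blast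
    then show ?thesis using graph_dist_eq_1_iff[OF assms(2,3)] by simp
  next
    case 3
    then show ?thesis using assms arcs_symmetric graph_dist_le_2[of u w v] by blast
  qed
qed

text \<open>Each vertex other than \<open>u\<close> contributes 1, and each non-neighbour one more.
  The \<open>+ 1\<close> avoids subtraction on naturals.\<close>

lemma T_diameter_2:
  assumes u: "u \<in> pverts G" and le: "\<And>v. v \<in> pverts G \<Longrightarrow> graph_dist G u v \<le> 2"
  shows "T u + 1 = card (pverts G) + card (nonneighbours G u)"
proof -
  have "graph_dist G u v = (if v \<in> pverts G - {u} then 1 else 0) + (if v \<in> nonneighbours G u then 1 else 0)"
    if v: "v \<in> pverts G" for v
    using le[OF v] graph_dist_eq_1_iff[OF u v] graph_dist_pos[OF u v] graph_dist_refl[OF u] v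
    by (auto simp: nonneighbours_def)
  then have "T u = (\<Sum>v\<in>pverts G. (if v \<in> pverts G - {u} then 1 else 0)
      + (if v \<in> nonneighbours G u then 1 else 0))"
    unfolding T_def by (intro sum.cong) auto
  also have "\<dots> = card (pverts G \<inter> (pverts G - {u})) + card (pverts G \<inter> nonneighbours G u)"
    using pair_finite_verts by (simp only: sum.distrib sum.inter_restrict[symmetric]) simp
  also have "pverts G \<inter> (pverts G - {u}) = pverts G - {u}" by blast
  also have "pverts G \<inter> nonneighbours G u = nonneighbours G u" by (auto simp: nonneighbours_def)
  finally show ?thesis
    using card_Suc_Diff1[OF pair_finite_verts u] by simp
qed

lemma T_dominating:
  assumes "w \<in> pverts G" "\<And>z. z \<in> pverts G \<Longrightarrow> z \<noteq> w \<Longrightarrow> (w, z) \<in> parcs G"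
  shows "T w + 1 = card (pverts G)"
proof -
  have "nonneighbours G w = {}" using assms by (auto simp: nonneighbours_def)
  then show ?thesis using T_diameter_2[OF assms(1)] graph_dist_dominated assms by auto
qed

text \<open>Matches the conclusions of \<open>gap_eqD\<close>: once \<open>w\<close> dominates, all
  distances are at most 2, and \<open>T v - T w\<close> counts the non-neighbours of
  \<open>v\<close>.\<close>

lemma hubI:
  assumes w: "w \<in> pverts G"
    and d: "\<And>v. v \<in> pverts G \<Longrightarrow> v \<noteq> w \<Longrightarrow> graph_dist G w v = 1"
    and T: "\<And>v. v \<in> pverts G \<Longrightarrow> v \<noteq> w \<Longrightarrow> T v = T w + c"
  shows "hub G w c"
proof -
  have adj: "(w, v) \<in> parcs G" if "v \<in> pverts G" "v \<noteq> w" for v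
    using d[OF that] graph_dist_eq_1_iff[OF w that(1)] by simp
  have "card (nonneighbours G v) = c" if v: "v \<in> pverts G" "v \<noteq> w" for v
    using T_diameter_2[OF v(1)] graph_dist_dominated[OF adj] v(1) T[OF v] T_dominating[OF w adj]
    by fastforce
  then show ?thesis using adj w by (simp add: hub_def)
qed

lemma hub_T:
  assumes "hub G w c"
  shows "T w + 1 = card (pverts G)"
    and "v \<in> pverts G \<Longrightarrow> v \<noteq> w \<Longrightarrow> T v + 1 = card (pverts G) + c"
proof -
  have w: "w \<in> pverts G" and adj: "\<And>z. z \<in> pverts G \<Longrightarrow> z \<noteq> w \<Longrightarrow> (w, z) \<in> parcs G"
    using assms by (auto simp: hub_def)
  show "T w + 1 = card (pverts G)" using T_dominating[OF w adj] by blast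
  show "T v + 1 = card (pverts G) + c" if "v \<in> pverts G" "v \<noteq> w"
    using T_diameter_2[OF that(1)] graph_dist_dominated[OF adj] that assms by (auto simp: hub_def)
qed

lemma hub_D_max:
  assumes "hub G w c" "1 < card (pverts G)"
  shows "D_max G + 1 = card (pverts G) + c"
proof -
  have w: "w \<in> pverts G" using assms by (simp add: hub_def)
  have "card (pverts G - {w}) \<noteq> 0" using assms w pair_finite_verts by simp
  then obtain v where v: "v \<in> pverts G" "v \<noteq> w"
    by (metis Diff_iff card.empty ex_in_conv singletonI)
  have "Max (T ` pverts G) = T v"
  proof (rule Max_eqI)
    fix t assume "t \<in> T ` pverts G"
    then show "t \<le> T v" using hub_T[OF assms(1)] v by (metis Suc_eq_plus1 Suc_le_mono imageE le_add1 order_refl)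
  qed (use v pair_finite_verts in auto)
  then show ?thesis
    using hub_T(2)[OF assms(1) v] by (simp add: D_max_def T_eq_transmission)
qed

text \<open>The extremal vector of the star form is an eigenvector of the distances. Rows other than
  \<open>w\<close> hold since \<open>T v\<close> is \<open>D_max G\<close> and \<open>w\<close> is
  at distance 1; the row of \<open>w\<close> is the quadratic equation of
  \<open>gap\<close>.\<close>

lemma hub_eigenpair:
  fixes c :: nat and g :: real
  assumes hub: "hub G w c" and card: "1 < card (pverts G)" and "0 < c"
  defines "g \<equiv> gap (card (pverts G)) c"
  shows "distance_eigenpair G (D_max G - g) (\<lambda>v. if v = w then 1 - g else 1)"
  unfolding distance_eigenpair_def
proof (intro conjI ballI)
  define n where "n = real (card (pverts G))"
  have n: "1 < n" using card by (simp add: n_def)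
  have w: "w \<in> pverts G" and adj: "\<And>z. z \<in> pverts G \<Longrightarrow> z \<noteq> w \<Longrightarrow> (w, z) \<in> parcs G"
    using hub by (auto simp: hub_def)
  have "g < 1" using gap_bounds[of "card (pverts G)" c] assms by simp
  then show "\<exists>v\<in>pverts G. (if v = w then 1 - g else 1) \<noteq> 0" using w by auto
  have D: "real (D_max G) = n + c - 1"
    using hub_D_max[OF hub card] by (simp add: n_def)
  have root: "g\<^sup>2 - (n + c) * g + c = 0"
    using gap_root[of n c] n \<open>0 < c\<close> by (simp add: g_def n_def)
  fix v assume v: "v \<in> pverts G"
  have "(\<Sum>u\<in>pverts G. real (graph_dist G v u) * (if u = w then 1 - g else 1))
    = (\<Sum>u\<in>pverts G. real (graph_dist G v u)) - (\<Sum>u\<in>pverts G. if u = w then real (graph_dist G v w) * g else 0)"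
    unfolding sum_subtractf[symmetric] by (intro sum.cong) (auto simp: algebra_simps)
  also have "\<dots> = T v - graph_dist G v w * g"
    using w pair_finite_verts by (simp add: T_def)
  also have "\<dots> = (D_max G - g) * (if v = w then 1 - g else 1)"
  proof (cases "v = w")
    case True
    have "real (T v) = n - 1" using hub_T(1)[OF hub] True by (simp add: n_def)
    then show ?thesis
      using True w root by (simp add: D graph_dist_refl power2_eq_square algebra_simps)
  next
    case False
    have "real (T v) = n + c - 1" using hub_T(2)[OF hub v False] by (simp add: n_def)
    moreover have "graph_dist G v w = 1"
      using adj[OF v False] graph_dist_eq_1_iff[OF w v] graph_dist_sym by metis
    ultimately show ?thesis using False by (simp add: D)
  qed
  finally show "(\<Sum>u\<in>pverts G. real (graph_dist G v u) * (if u = w then 1 - g else 1))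
    = (D_max G - g) * (if v = w then 1 - g else 1)" .
qed

text \<open>One inequality is the general bound at \<open>w\<close>; the other holds because the
  spectral radius is at least the eigenvalue of the explicit pair.\<close>

lemma hub_imp_gap:
  assumes hub: "hub G w c" and card: "1 < card (pverts G)" and c: "0 < c"
  shows "D_max G - distance_spectral_radius G = gap (card (pverts G)) c"
proof -
  obtain x where "distance_eigenpair G (distance_spectral_radius G) x"
    using distance_spectral_radius_eigenpair ..
  then interpret eigen_distance "pverts G" "graph_dist G" "D_max G" "distance_spectral_radius G" x
    by (rule eigen_distanceI)
  have w: "w \<in> pverts G" using hub by (simp add: hub_def)
  have "real c \<le> real (D_max G) - T w"
    using hub_T(1)[OF hub] hub_D_max[OF hub card] by linarith
  with gap_le[OF w card] c have "gap (card (pverts G)) c \<le> D_max G - distance_spectral_radius G"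
    by simp
  moreover have "D_max G - gap (card (pverts G)) c \<le> distance_spectral_radius G"
    using hub_eigenpair[OF hub card c] by (rule distance_spectral_radius_ge)
  ultimately show ?thesis by simp
qed

section \<open>Bounds and equality cases for irregular graphs in terms of hubs\<close>

lemma not_transmission_regularE:
  assumes "\<not> transmission_regular G"
  obtains w z where "w \<in> pverts G" "z \<in> pverts G" "T w < D_max G" "T z = D_max G" "w \<noteq> z"
proof -
  have fin: "finite (T ` pverts G)" and ne: "T ` pverts G \<noteq> {}"
    using pair_finite_verts nonempty by auto
  have D: "D_max G = Max (T ` pverts G)" "D_min G = Min (T ` pverts G)"
    by (simp_all add: D_max_def D_min_def T_eq_transmission)
  obtain w z where "w \<in> pverts G" "T w = D_min G" "z \<in> pverts G" "T z = D_max G"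
    using Min_in[OF fin ne] Max_in[OF fin ne] unfolding D by force
  moreover from this have "T w < D_max G"
    using assms transmission_le_D_max[of w]
    by (auto simp: transmission_regular_def T_eq_transmission)
  ultimately show ?thesis using that by force
qed

text \<open>On two vertices, symmetry of the distance makes both transmissions equal.\<close>

lemma card_gt_2:
  assumes "\<not> transmission_regular G"
  shows "2 < card (pverts G)"
proof (rule ccontr)
  assume small: "\<not> ?thesis"
  obtain w z where w: "w \<in> pverts G" "z \<in> pverts G" "T w < D_max G" "T z = D_max G" "w \<noteq> z"
    using not_transmission_regularE[OF assms] .
  have V: "pverts G = {w, z}"
    using w small pair_finite_verts by (intro card_seteq[symmetric]) auto
  then have "T w = graph_dist G w z" "T z = graph_dist G z w"
    using w graph_dist_refl unfolding T_def by (simp_all add: V)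
  then show False using w graph_dist_sym[of w z] by simp
qed

lemma
  assumes irregular: "\<not> transmission_regular G"
  shows gap_1_le: "gap (card (pverts G)) 1 \<le> D_max G - distance_spectral_radius G"
    and gap_1_eqD: "D_max G - distance_spectral_radius G = gap (card (pverts G)) 1 \<Longrightarrow> \<exists>w. hub G w 1"
    and gap_2_le: "even (card (pverts G)) \<Longrightarrow>
      gap (card (pverts G)) 2 \<le> D_max G - distance_spectral_radius G"
    and gap_2_eqD: "even (card (pverts G)) \<Longrightarrow>
      D_max G - distance_spectral_radius G = gap (card (pverts G)) 2 \<Longrightarrow> \<exists>w. hub G w 2"
proof -
  obtain w z where w: "w \<in> pverts G" "T w < D_max G" and z: "z \<in> pverts G" "T z = D_max G"
    using not_transmission_regularE[OF irregular] by metis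
  have card: "1 < card (pverts G)" using card_gt_2[OF irregular] by simp
  obtain x where "distance_eigenpair G (distance_spectral_radius G) x"
    using distance_spectral_radius_eigenpair ..
  then interpret eigen_distance "pverts G" "graph_dist G" "D_max G" "distance_spectral_radius G" x
    by (rule eigen_distanceI)
  have hub: "\<exists>w. hub G w c"
    if "0 < c" "c \<le> D_max G - T w" "D_max G - distance_spectral_radius G = gap (card (pverts G)) c" for c
  proof -
    have "real c \<le> real (D_max G) - T w" using that w by linarith
    note D = gap_eqD[OF w(1) card _ this that(3)]
    have "hub G w c"
    proof (rule hubI)
      show "T v = T w + c" if "v \<in> pverts G" "v \<noteq> w" for v
        using D(1) D(2)[OF _ that] \<open>0 < c\<close> w by simp
    qed (use D(3) w \<open>0 < c\<close> in auto)
    then show ?thesis ..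
  qed
  have "real 1 \<le> real (D_max G) - T w" using w by linarith
  then show "gap (card (pverts G)) 1 \<le> D_max G - distance_spectral_radius G"
    using gap_le[OF w(1) card, of 1] by simp
  show "\<exists>w. hub G w 1" if "D_max G - distance_spectral_radius G = gap (card (pverts G)) 1"
    using hub[of 1] that w by simp
  assume even: "even (card (pverts G))"
  \<comment> \<open>Either a second vertex is deficient and the bound is strict, or \<open>w\<close>
    carries the whole deficit, which parity then forces to be at least 2.\<close>
  have dichotomy: "gap (card (pverts G)) 2 < D_max G - distance_spectral_radius G \<or> 2 \<le> D_max G - T w"
  proof (cases "\<exists>w'\<in>pverts G. w' \<noteq> w \<and> T w' < D_max G")
    case True
    then show ?thesis using gap_less_two_deficits[OF w(1) _ _ w(2) _ z] by auto
  next
    case False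
    then have "T v = D_max G" if "v \<in> pverts G - {w}" for v
      using that T_le[of v] by force
    then have "(\<Sum>v\<in>pverts G. T v) = T w + (card (pverts G) - 1) * D_max G"
      using w(1) pair_finite_verts by (simp add: sum.remove[of _ w])
    moreover have "D_max G + (card (pverts G) - 1) * D_max G = card (pverts G) * D_max G"
      using card by (simp add: diff_mult_distrib)
    \<comment> \<open>Both the transmission sum and \<open>card (pverts G) * D_max G\<close> are
      even, and they differ by the deficit of \<open>w\<close>.\<close>
    ultimately have "even (D_max G + T w)"
      using even_sum_T even by (metis even_add even_mult_iff)
    then have "D_max G \<noteq> T w + 1" by auto
    then show ?thesis using w(2) by linarith
  qed
  have "gap (card (pverts G)) 2 \<le> D_max G - distance_spectral_radius G" if "2 \<le> D_max G - T w"
    using gap_le[OF w(1) card, of 2] that w(2) by simp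
  then show "gap (card (pverts G)) 2 \<le> D_max G - distance_spectral_radius G"
    using dichotomy by auto
  show "\<exists>w. hub G w 2" if "D_max G - distance_spectral_radius G = gap (card (pverts G)) 2"
    using dichotomy hub[of 2] that by auto
qed

end

section \<open>Isomorphism\<close>

text \<open>An isomorphism carries separate maps on vertices and arcs. Since arcs are pairs with
  \<open>fst\<close> as tail and \<open>snd\<close> as head, the vertex map determines the arc
  map.\<close>

lemma digraph_iso_with_proj_iff:
  assumes "pair_wf_digraph G" "pair_wf_digraph H"
  shows "digraph_iso G H \<longleftrightarrow> (\<exists>f. bij_betw f (pverts G) (pverts H) \<and>
    (\<forall>u\<in>pverts G. \<forall>v\<in>pverts G. (f u, f v) \<in> parcs H \<longleftrightarrow> (u, v) \<in> parcs G))"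
proof
  interpret G: pair_wf_digraph G by fact
  assume "digraph_iso G H"
  then obtain h where h: "pre_digraph.digraph_isomorphism G h" and "with_proj H = app_iso h G"
    by (auto simp: digraph_iso_def)
  then have H: "pverts H = iso_verts h ` pverts G" "parcs H = iso_arcs h ` parcs G"
      "iso_tail h = fst" "iso_head h = snd"
    by (simp_all add: with_proj_def app_iso_def)
  have arc: "iso_arcs h e = map_prod (iso_verts h) (iso_verts h) e" if "e \<in> parcs G" for e
    using h that H(3,4) by (auto simp: pre_digraph.digraph_isomorphism_def map_prod_def split_beta prod_eq_iff)
  have inj: "inj_on (iso_verts h) (pverts G)"
    using h by (simp add: pre_digraph.digraph_isomorphism_def)
  have "(iso_verts h u, iso_verts h v) \<in> parcs H \<longleftrightarrow> (u, v) \<in> parcs G"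
    if uv: "u \<in> pverts G" "v \<in> pverts G" for u v
  proof
    assume "(iso_verts h u, iso_verts h v) \<in> parcs H"
    then obtain u' v' where "(u', v') \<in> parcs G" "iso_verts h u = iso_verts h u'" "iso_verts h v = iso_verts h v'"
      using arc by (force simp: H(2))
    then show "(u, v) \<in> parcs G"
      using inj uv G.wellformed' by (metis inj_onD)
  next
    assume "(u, v) \<in> parcs G"
    then show "(iso_verts h u, iso_verts h v) \<in> parcs H"
      using arc by (force simp: H(2))
  qed
  with inj show "\<exists>f. bij_betw f (pverts G) (pverts H) \<and>
    (\<forall>u\<in>pverts G. \<forall>v\<in>pverts G. (f u, f v) \<in> parcs H \<longleftrightarrow> (u, v) \<in> parcs G)"
    unfolding bij_betw_def H(1) by blast
next
  interpret G: pair_wf_digraph G by fact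
  interpret H: pair_wf_digraph H by fact
  assume "\<exists>f. bij_betw f (pverts G) (pverts H) \<and>
    (\<forall>u\<in>pverts G. \<forall>v\<in>pverts G. (f u, f v) \<in> parcs H \<longleftrightarrow> (u, v) \<in> parcs G)"
  then obtain f where inj: "inj_on f (pverts G)" and im: "f ` pverts G = pverts H"
    and arc: "\<And>u v. u \<in> pverts G \<Longrightarrow> v \<in> pverts G \<Longrightarrow> (f u, f v) \<in> parcs H \<longleftrightarrow> (u, v) \<in> parcs G"
    unfolding bij_betw_def by blast
  define h where "h = \<lparr>iso_verts = f, iso_arcs = map_prod f f, iso_head = snd, iso_tail = fst\<rparr>"
  have "inj_on (map_prod f f) (parcs G)"
    by (rule inj_on_subset[OF map_prod_inj_on[OF inj inj]]) (use G.wellformed' in auto)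
  moreover have "wf_digraph (with_proj G)" by unfold_locales
  ultimately have "pre_digraph.digraph_isomorphism G h"
    using inj by (simp add: pre_digraph.digraph_isomorphism_def h_def)
  moreover have "parcs H = map_prod f f ` parcs G"
  proof (intro equalityI subsetI)
    fix e assume e: "e \<in> parcs H"
    then obtain u v where "e = (f u, f v)" "u \<in> pverts G" "v \<in> pverts G"
      using H.wellformed' im by (cases e) (metis imageE)
    then show "e \<in> map_prod f f ` parcs G" using e arc by (auto intro: rev_image_eqI)
  next
    fix e assume "e \<in> map_prod f f ` parcs G"
    then show "e \<in> parcs H" using arc G.wellformed' by auto
  qed
  then have "with_proj H = app_iso h G"
    using im by (simp add: with_proj_def app_iso_def h_def)
  ultimately show "digraph_iso G H" by (auto simp: digraph_iso_def)
qed

lemma hub_iso: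
  assumes wf: "pair_wf_digraph G" "pair_wf_digraph H" and iso: "digraph_iso G H" and hub: "hub H y c"
  shows "\<exists>w. hub G w c"
proof -
  obtain f where inj: "inj_on f (pverts G)" and im: "f ` pverts G = pverts H"
    and arc: "\<And>u v. u \<in> pverts G \<Longrightarrow> v \<in> pverts G \<Longrightarrow> (f u, f v) \<in> parcs H \<longleftrightarrow> (u, v) \<in> parcs G"
    using iso unfolding digraph_iso_with_proj_iff[OF wf] bij_betw_def by blast
  have non: "nonneighbours H (f u) = f ` nonneighbours G u" if u: "u \<in> pverts G" for u
    unfolding nonneighbours_def im[symmetric] using u arc inj by (auto simp: inj_on_eq_iff)
  have card: "card (nonneighbours H (f u)) = card (nonneighbours G u)" if u: "u \<in> pverts G" for u
    unfolding non[OF u]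
    by (rule card_image) (rule inj_on_subset[OF inj], auto simp: nonneighbours_def)
  obtain w where w: "w \<in> pverts G" "y = f w" using hub im by (auto simp: hub_def)
  have "(w, u) \<in> parcs G \<and> card (nonneighbours G u) = c" if u: "u \<in> pverts G - {w}" for u
  proof -
    have "f u \<in> pverts H - {y}" using u w inj im by (auto simp: inj_on_eq_iff)
    then have "(f w, f u) \<in> parcs H" "card (nonneighbours H (f u)) = c"
      using hub w by (auto simp: hub_def)
    then show ?thesis using arc[OF w(1)] card u by auto
  qed
  then show ?thesis using w by (auto simp: hub_def)
qed

lemma digraph_iso_card:
  assumes "pair_wf_digraph G" "pair_wf_digraph H" "digraph_iso G H"
  shows "card (pverts G) = card (pverts H)"
  using assms digraph_iso_with_proj_iff bij_betw_same_card by blast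

section \<open>Degrees and the correspondence between hubs and DVDR graphs\<close>

context connected_pair_graph
begin

lemma out_degree_nonneighbours:
  assumes u: "u \<in> pverts G"
  shows "out_degree G u + card (nonneighbours G u) + 1 = card (pverts G)"
proof -
  let ?N = "{z. (u, z) \<in> parcs G}"
  have "out_arcs G u = Pair u ` ?N" by (auto simp: out_arcs_def)
  then have deg: "out_degree G u = card ?N"
    unfolding out_degree_def by (simp add: card_image inj_on_def)
  have sub: "?N \<subseteq> pverts G" using wellformed' by blast
  have "pverts G = insert u (?N \<union> nonneighbours G u)"
    using u sub by (auto simp: nonneighbours_def)
  moreover have "u \<notin> ?N \<union> nonneighbours G u" "?N \<inter> nonneighbours G u = {}"
    using no_loops' by (auto simp: nonneighbours_def)
  moreover have "finite ?N" using sub pair_finite_verts by (rule finite_subset)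
  ultimately have "card (pverts G) = Suc (card ?N + card (nonneighbours G u))"
    using finite_nonneighbours by (metis card_Un_disjoint card_insert_disjoint finite_Un)
  then show ?thesis by (simp add: deg)
qed

lemma out_degree_del_vert:
  assumes "(u, w) \<in> parcs G"
  shows "out_degree (pre_digraph.del_vert G w) u + 1 = out_degree G u"
proof -
  have "u \<noteq> w" using assms no_loops' by blast
  then have "out_arcs (pre_digraph.del_vert G w) u = out_arcs G u - {(u, w)}"
    by (auto simp: out_arcs_def del_vert_simps)
  moreover have "(u, w) \<in> out_arcs G u" using assms by (simp add: out_arcs_def)
  moreover have "finite (out_arcs G u)" using pair_finite_arcs by (simp add: out_arcs_def)
  ultimately show ?thesis
    unfolding out_degree_def using card_Suc_Diff1 by fastforce
qed

text \<open>Deleting a dominating \<open>w\<close> lowers every other degree by one, so a vertex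
  with \<open>m\<close> non-neighbours keeps degree \<open>n - 2 - m\<close>. The bound on the order
  makes the natural subtraction \<open>n - 4\<close> exact.\<close>

lemma DVDR_iff_hub:
  assumes n: "4 \<le> card (pverts G)"
  shows "DVDR (card (pverts G) - 4) G \<longleftrightarrow> (\<exists>w. hub G w 2)"
proof -
  have "out_degree G w = card (pverts G) - 1 \<and> regular (card (pverts G) - 4) (pre_digraph.del_vert G w)
      \<longleftrightarrow> hub G w 2" if w: "w \<in> pverts G" for w
  proof -
    have "out_degree G w = card (pverts G) - 1 \<longleftrightarrow> nonneighbours G w = {}"
      using out_degree_nonneighbours[OF w] finite_nonneighbours[of w] by (auto simp flip: card_0_eq)
    also have "\<dots> \<longleftrightarrow> (\<forall>u\<in>pverts G - {w}. (w, u) \<in> parcs G)"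
      by (auto simp: nonneighbours_def)
    finally have dom: "out_degree G w = card (pverts G) - 1 \<longleftrightarrow> (\<forall>u\<in>pverts G - {w}. (w, u) \<in> parcs G)" .
    have "out_degree (pre_digraph.del_vert G w) u = card (pverts G) - 4 \<longleftrightarrow> card (nonneighbours G u) = 2"
      if "u \<in> pverts G - {w}" "(w, u) \<in> parcs G" for u
      using out_degree_del_vert[OF arcs_symmetric[OF that(2)]] out_degree_nonneighbours[of u] that(1) n
      by auto
    then show ?thesis
      unfolding dom hub_def regular_def using w by (auto simp: del_vert_simps)
  qed
  moreover have "hub G w 2 \<Longrightarrow> w \<in> pverts G" for w by (simp add: hub_def)
  ultimately show ?thesis
    unfolding DVDR_def using pair_graph connected by blast
qed

text \<open>The hub, another vertex \<open>v\<close> and the two non-neighbours of \<open>v\<close>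
  are four distinct vertices.\<close>

lemma hub_2_card:
  assumes "hub G w 2" "1 < card (pverts G)"
  shows "4 \<le> card (pverts G)"
proof -
  have w: "w \<in> pverts G" using assms by (simp add: hub_def)
  have "card (pverts G - {w}) \<noteq> 0" using assms w pair_finite_verts by simp
  then obtain v where v: "v \<in> pverts G" "v \<noteq> w"
    by (metis Diff_iff card.empty ex_in_conv singletonI)
  have "(v, w) \<in> parcs G" using assms v arcs_symmetric by (simp add: hub_def)
  then have "w \<notin> nonneighbours G v" "v \<notin> nonneighbours G v" by (auto simp: nonneighbours_def)
  moreover have "card (nonneighbours G v) = 2" using assms v by (simp add: hub_def)
  ultimately have "card (insert v (insert w (nonneighbours G v))) = 4"
    using finite_nonneighbours[of v] v by simp
  moreover have "insert v (insert w (nonneighbours G v)) \<subseteq> pverts G"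
    using v w by (auto simp: nonneighbours_def)
  ultimately show ?thesis using card_mono[OF pair_finite_verts] by metis
qed

end

section \<open>The graph K_{1,2,...,2} as the graph with a hub for c = 1\<close>

definition cocktail :: "nat \<Rightarrow> (nat \<times> nat) pair_pre_digraph" where
  "cocktail k = complete_multipartite (1 # replicate k 2)"

lemma pverts_cocktail: "pverts (cocktail k) = insert (0, 0) ({1..k} \<times> {0, 1})"
proof -
  have "pverts (cocktail k) = {(i, j). i < Suc k \<and> j < (1 # replicate k 2) ! i}"
    by (simp add: cocktail_def complete_multipartite_def Let_def)
  also have "\<dots> = {(i, j). i < Suc k \<and> j < (if i = 0 then 1 else 2)}"
    by (intro Collect_cong) (auto simp: nth_Cons' split: if_splits)
  also have "\<dots> = insert (0, 0) ({1..k} \<times> {0, 1})"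
    by (auto simp: less_2_cases_iff split: if_splits)
  finally show ?thesis .
qed

lemma parcs_cocktail:
  "(x, y) \<in> parcs (cocktail k) \<longleftrightarrow> x \<in> pverts (cocktail k) \<and> y \<in> pverts (cocktail k) \<and> fst x \<noteq> fst y"
  by (auto simp: cocktail_def complete_multipartite_def Let_def)

lemma pair_wf_digraph_cocktail: "pair_wf_digraph (cocktail k)"
  by unfold_locales (auto simp: cocktail_def complete_multipartite_def Let_def)

lemma hub_cocktail: "hub (cocktail k) (0, 0) 1"
proof -
  have "((0, 0), u) \<in> parcs (cocktail k) \<and> card (nonneighbours (cocktail k) u) = 1"
    if vertex: "u \<in> pverts (cocktail k) - {(0, 0)}" for u
  proof -
    obtain i j where u: "u = (i, j)" "i \<in> {1..k}" "j \<in> {0, 1}"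
      using vertex by (auto simp: pverts_cocktail)
    then have "nonneighbours (cocktail k) u = {(i, 1 - j)}"
      by (auto simp: nonneighbours_def parcs_cocktail pverts_cocktail)
    then show ?thesis using u by (auto simp: parcs_cocktail pverts_cocktail)
  qed
  then show ?thesis by (auto simp: hub_def pverts_cocktail)
qed

text \<open>Away from \<open>w\<close>, non-adjacency pairs up the vertices; the pairs are the parts of size two.\<close>

lemma (in connected_pair_graph) hub_1_imp_cocktail:
  assumes hub: "hub G w 1"
  shows "\<exists>k. card (pverts G) = 2 * k + 1 \<and> digraph_iso G (cocktail k)"
proof -
  define U where "U = pverts G - {w}"
  have w: "w \<in> pverts G" using hub by (simp add: hub_def)
  have finU: "finite U" using pair_finite_verts by (simp add: U_def)
  have "\<exists>z. nonneighbours G u = {z}" if "u \<in> U" for u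
    using hub that by (auto simp: hub_def U_def card_1_singleton_iff)
  then obtain p where p: "\<And>u. u \<in> U \<Longrightarrow> nonneighbours G u = {p u}" by metis
  have adj_iff: "(u, v) \<in> parcs G \<longleftrightarrow> v \<noteq> u \<and> v \<noteq> p u" if "u \<in> U" "v \<in> pverts G" for u v
    using p[OF that(1)] that no_loops' by (auto simp: nonneighbours_def)
  have pU: "p u \<in> U" "p u \<noteq> u" if u: "u \<in> U" for u
  proof -
    have "p u \<in> nonneighbours G u" using p[OF u] by simp
    moreover have "(u, w) \<in> parcs G" using hub u arcs_symmetric by (simp add: hub_def U_def)
    ultimately show "p u \<in> U" "p u \<noteq> u" by (auto simp: nonneighbours_def U_def)
  qed
  \<comment> \<open>Non-adjacency is symmetric, so the map to the unique non-neighbour is an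
    involution.\<close>
  have pp: "p (p u) = u" if u: "u \<in> U" for u
  proof -
    have "(p u, u) \<notin> parcs G"
      using adj_iff[OF u] pU[OF u] arcs_symmetric unfolding U_def by blast
    then show ?thesis using adj_iff[OF pU(1)[OF u]] pU[OF u] u by (auto simp: U_def)
  qed
  define P where "P u = {u, p u}" for u
  have P_eq: "P u = P v \<longleftrightarrow> v = u \<or> v = p u" if "u \<in> U" "v \<in> U" for u v
    using pp that by (auto simp: P_def doubleton_eq_iff)
  define k where "k = card (P ` U)"
  have "k * 2 = card (\<Union> (P ` U))"
    unfolding k_def mult.commute[of _ 2]
  proof (rule card_partition)
    show "finite (\<Union> (P ` U))" using finU by (auto simp: P_def)
    show "card c = 2" if c: "c \<in> P ` U" for c
    proof -
      obtain u where "u \<in> U" "c = {u, p u}" using c by (auto simp: P_def)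
      then show ?thesis using pU(2)[of u] by auto
    qed
    show "c1 \<inter> c2 = {}" if c: "c1 \<in> P ` U" "c2 \<in> P ` U" "c1 \<noteq> c2" for c1 c2
    proof (rule ccontr)
      obtain u v where uv: "u \<in> U" "c1 = P u" "v \<in> U" "c2 = P v" using c by blast
      assume "c1 \<inter> c2 \<noteq> {}"
      then have "u = v \<or> u = p v \<or> v = p u \<or> p u = p v"
        unfolding uv P_def by auto
      then have "v = u \<or> v = p u" using pp uv by metis
      then show False using P_eq uv c(3) by simp
    qed
  qed (use finU in simp)
  also have "\<Union> (P ` U) = U" using pU by (auto simp: P_def)
  finally have cardU: "card U = 2 * k" by simp
  then have cardV: "card (pverts G) = 2 * k + 1"
    using card_Suc_Diff1[OF pair_finite_verts w] by (simp add: U_def)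
  obtain h where h: "bij_betw h (P ` U) {0..<k}"
    using ex_bij_betw_finite_nat[of "P ` U"] finU by (auto simp: k_def)
  \<comment> \<open>A chosen representative of each pair; it tells the two members apart in the
    second coordinate of \<open>f\<close>.\<close>
  define r where "r s = (SOME z. z \<in> s)" for s :: "'a set"
  have r: "r (P u) = u \<or> r (P u) = p u" for u
    using someI[of "\<lambda>z. z \<in> P u" u] by (auto simp: r_def P_def)
  \<comment> \<open>The \<open>Suc\<close> shifts the numbering of the pairs past part 0, which
    consists of \<open>w\<close> alone.\<close>
  define f :: "'a \<Rightarrow> nat \<times> nat" where
    "f u = (if u = w then (0, 0) else (Suc (h (P u)), if u = r (P u) then 0 else 1))" for u
  have fst_f: "fst (f u) = fst (f v) \<longleftrightarrow> v = u \<or> v = p u" if "u \<in> U" "v \<in> U" for u v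
  proof -
    have "h (P u) = h (P v) \<longleftrightarrow> P u = P v"
      using h that by (intro inj_on_eq_iff[of h "P ` U"]) (auto simp: bij_betw_def)
    then show ?thesis using that P_eq by (simp add: f_def U_def)
  qed
  have fst_w: "fst (f u) \<noteq> fst (f w)" if "u \<in> U" for u
    using that by (simp add: f_def U_def)
  have inj: "inj_on f (pverts G)"
  proof (rule inj_onI)
    fix u v assume uv: "u \<in> pverts G" "v \<in> pverts G" "f u = f v"
    consider "u = w" "v = w" | "u \<in> U" "v = w" | "u = w" "v \<in> U" | "u \<in> U" "v \<in> U"
      using uv by (auto simp: U_def)
    then show "u = v"
    proof cases
      case 4
      then consider "v = u" | "v = p u" using fst_f uv(3) by metis
      then show ?thesis
      proof cases
        case 2
        then have "P v = P u" using 4 P_eq by metis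
        then show ?thesis
          using uv(3) 4 r[of u] 2 by (auto simp: f_def U_def split: if_splits)
      qed simp
    qed (use fst_w uv(3) in force)+
  qed
  have "f ` pverts G \<subseteq> pverts (cocktail k)"
  proof (rule image_subsetI)
    fix u assume "u \<in> pverts G"
    moreover have "h (P u) < k" if "u \<in> U" using h that by (auto simp: bij_betw_def)
    ultimately show "f u \<in> pverts (cocktail k)"
      unfolding pverts_cocktail by (auto simp: f_def U_def Suc_le_eq)
  qed
  moreover have "card (pverts (cocktail k)) = 2 * k + 1"
    unfolding pverts_cocktail by simp
  then have "card (f ` pverts G) = card (pverts (cocktail k))" using card_image[OF inj] cardV by simp
  \<comment> \<open>Surjectivity by counting: an injective image inside a finite set of the same
    size.\<close>
  ultimately have im: "f ` pverts G = pverts (cocktail k)"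
    by (intro card_subset_eq) (simp_all add: pverts_cocktail)
  have "(f u, f v) \<in> parcs (cocktail k) \<longleftrightarrow> (u, v) \<in> parcs G" if uv: "u \<in> pverts G" "v \<in> pverts G" for u v
  proof -
    have "(f u, f v) \<in> parcs (cocktail k) \<longleftrightarrow> fst (f u) \<noteq> fst (f v)"
      using uv im by (auto simp: parcs_cocktail)
    moreover consider "u = w" "v = w" | "u \<in> U" "v = w" | "u = w" "v \<in> U" | "u \<in> U" "v \<in> U"
      using uv by (auto simp: U_def)
    then have "fst (f u) \<noteq> fst (f v) \<longleftrightarrow> (u, v) \<in> parcs G"
    proof cases
      case 1
      then show ?thesis using no_loops' by blast
    next
      case 2
      then show ?thesis using fst_w[of u] hub arcs_symmetric by (simp add: hub_def U_def)
    next
      case 3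
      then show ?thesis using fst_w[of v] hub by (auto simp: hub_def U_def)
    next
      case 4
      then show ?thesis using fst_f adj_iff uv by simp
    qed
    ultimately show ?thesis by simp
  qed
  moreover have "pair_wf_digraph G" ..
  ultimately show ?thesis
    using inj im cardV digraph_iso_with_proj_iff pair_wf_digraph_cocktail
    unfolding bij_betw_def by blast
qed

section \<open>Hubs translated into the two equality cases\<close>

theorem theorem1p2:
  fixes G :: "'a pair_pre_digraph" and n :: nat
  assumes "pair_graph G"
    and "Digraph_Component.connected G"
    and "\<not> transmission_regular G"
    and "card (pverts G) = n"
  shows "(odd n \<longrightarrow>
      real (D_max G) - distance_spectral_radius G
        \<ge> (real n + 1 - sqrt ((real n - 1) * (real n + 3))) / 2 \<and>
      (real (D_max G) - distance_spectral_radius G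
        = (real n + 1 - sqrt ((real n - 1) * (real n + 3))) / 2 \<longleftrightarrow>
       (\<exists>r\<ge>1. n = 2 * r - 1 \<and>
          digraph_iso G (complete_multipartite (1 # replicate (r - 1) 2))))) \<and>
    (even n \<longrightarrow>
      real (D_max G) - distance_spectral_radius G
        \<ge> (real n + 2 - sqrt ((real n)\<^sup>2 + 4 * real n - 4)) / 2 \<and>
      (real (D_max G) - distance_spectral_radius G
        = (real n + 2 - sqrt ((real n)\<^sup>2 + 4 * real n - 4)) / 2 \<longleftrightarrow>
       (\<exists>H :: 'a pair_pre_digraph. DVDR (n - 4) H \<and> digraph_iso G H)))"
proof -
  interpret connected_pair_graph G
    using assms by (simp add: connected_pair_graph_def connected_pair_graph_axioms_def)
  note irregular = \<open>\<not> transmission_regular G\<close>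
  note n = \<open>card (pverts G) = n\<close>
  have card: "1 < card (pverts G)" using card_gt_2[OF irregular] by simp
  have wf: "pair_wf_digraph G" ..
  have gap_1: "(real n + 1 - sqrt ((real n - 1) * (real n + 3))) / 2 = gap n 1"
    by (simp add: gap_def power2_eq_square algebra_simps)
  have gap_2: "(real n + 2 - sqrt ((real n)\<^sup>2 + 4 * real n - 4)) / 2 = gap n 2"
    by (simp add: gap_def power2_eq_square algebra_simps)
  have hub_1: "D_max G - distance_spectral_radius G = gap n 1 \<longleftrightarrow> (\<exists>w. hub G w 1)"
    using gap_1_eqD[OF irregular] hub_imp_gap[OF _ card, of _ 1] n by auto
  have hub_2: "D_max G - distance_spectral_radius G = gap n 2 \<longleftrightarrow> (\<exists>w. hub G w 2)" if "even n"
    using gap_2_eqD[OF irregular] hub_imp_gap[OF _ card, of _ 2] n that by auto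
  have cocktail: "(\<exists>w. hub G w 1) \<longleftrightarrow>
    (\<exists>r\<ge>1. n = 2 * r - 1 \<and> digraph_iso G (complete_multipartite (1 # replicate (r - 1) 2)))"
  proof
    assume "\<exists>w. hub G w 1"
    then obtain k where "n = 2 * k + 1" "digraph_iso G (cocktail k)"
      using hub_1_imp_cocktail n by blast
    then show "\<exists>r\<ge>1. n = 2 * r - 1 \<and> digraph_iso G (complete_multipartite (1 # replicate (r - 1) 2))"
      \<comment> \<open>The number of parts is \<open>Suc k\<close>: \<open>k\<close> pairs and the
        singleton.\<close>
      by (intro exI[of _ "Suc k"]) (simp add: cocktail_def)
  next
    assume "\<exists>r\<ge>1. n = 2 * r - 1 \<and> digraph_iso G (complete_multipartite (1 # replicate (r - 1) 2))"
    then show "\<exists>w. hub G w 1"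
      using hub_iso[OF wf pair_wf_digraph_cocktail _ hub_cocktail] unfolding cocktail_def by blast
  qed
  have DVDR: "(\<exists>w. hub G w 2) \<longleftrightarrow> (\<exists>H :: 'a pair_pre_digraph. DVDR (n - 4) H \<and> digraph_iso G H)"
    if "even n"
  proof
    assume hub: "\<exists>w. hub G w 2"
    then have "4 \<le> card (pverts G)" using hub_2_card card by blast
    then have "DVDR (n - 4) G" using hub DVDR_iff_hub n by blast
    moreover have "digraph_iso G G"
      unfolding digraph_iso_with_proj_iff[OF wf wf] by (intro exI[of _ id]) simp
    ultimately show "\<exists>H :: 'a pair_pre_digraph. DVDR (n - 4) H \<and> digraph_iso G H" by blast
  next
    assume "\<exists>H :: 'a pair_pre_digraph. DVDR (n - 4) H \<and> digraph_iso G H"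
    then obtain H :: "'a pair_pre_digraph" where H: "DVDR (n - 4) H" and iso: "digraph_iso G H"
      by blast
    interpret H: connected_pair_graph H
      using H by (simp add: DVDR_def connected_pair_graph_def connected_pair_graph_axioms_def)
    have wfH: "pair_wf_digraph H" ..
    \<comment> \<open>Irregularity gives \<open>2 < n\<close>, and evenness excludes 3, so
      \<open>n - 4\<close> is not truncated and \<open>DVDR_iff_hub\<close> applies to
      \<open>H\<close>.\<close>
    have "4 \<le> n" using card_gt_2[OF irregular] n that by presburger
    then show "\<exists>w. hub G w 2"
      using H.DVDR_iff_hub H hub_iso[OF wf wfH iso] digraph_iso_card[OF wf wfH iso] n by metis
  qed
  show ?thesis
    unfolding gap_1 gap_2
  proof (intro conjI impI)
    show "gap n 1 \<le> real (D_max G) - distance_spectral_radius G"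
      using gap_1_le[OF irregular] n by simp
    show "real (D_max G) - distance_spectral_radius G = gap n 1 \<longleftrightarrow>
      (\<exists>r\<ge>1. n = 2 * r - 1 \<and> digraph_iso G (complete_multipartite (1 # replicate (r - 1) 2)))"
      using hub_1 cocktail by (rule trans)
    assume "even n"
    show "gap n 2 \<le> real (D_max G) - distance_spectral_radius G"
      using gap_2_le[OF irregular] n \<open>even n\<close> by simp
    show "real (D_max G) - distance_spectral_radius G = gap n 2 \<longleftrightarrow>
      (\<exists>H :: 'a pair_pre_digraph. DVDR (n - 4) H \<and> digraph_iso G H)"
      using hub_2[OF \<open>even n\<close>] DVDR[OF \<open>even n\<close>] by (rule trans)
  qed
qed

end
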